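(* Let $T$ be a tree of order $n\ge 2$. Then every subtree root of $T$ lies in the disk $$\{z\in\mathbb{C}: |z|\le 1+\sqrt[n-1]{n-1}\}.$$ Moreover, $T$ has a subtree root on the boundary $|z|=1+(n-1)^{1/(n-1)}$ if and only if $n$ is even and $T\cong K_{1,n-1}$, and in this case the unique boundary root is $z=-1-(n-1)^{1/(n-1)}$.
   Context: The order of a tree is its number of vertices. A subtree of a tree $T$ is a nonempty connected subgraph of $T$ (equivalently, a nonempty vertex set inducing a connected subgraph). For a tree $T$ of order $n$, let $s_k(T)$ denote the number of subtrees of $T$ with exactly $k$ vertices. The subtree polynomial of $T$ is $\Phi_T(z)=\sum_{k=1}^{n}s_k(T)z^k$. The subtree roots of $T$ are the zeros in $\mathbb{C}$ of $\Phi_T(z)$. $K_{1,n-1}$ denotes the star of order $n$. *)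

theory Defs
  imports
    Complex_Main
    "HOL-Computational_Algebra.Polynomial"
    "Graph_Theory.Digraph_Isomorphism"
begin

text \<open>
  Finite simple graphs are symmetric loopfree digraphs, i.e. the locale \<open>pair_graph\<close>: an
  undirected edge \<open>{u, v}\<close> is the pair of arcs \<open>(u, v)\<close>, \<open>(v, u)\<close>.

  The constants \<open>forest\<close> and \<open>tree\<close> of \<open>Digraph_Component\<close> cannot be used for undirected trees
  in this encoding: the closed walk \<open>[(u, v), (v, u)]\<close> is a \<open>pre_digraph.cycle\<close>, so no symmetric
  digraph with an edge satisfies them. The (directed) cycles of length at least 3 are exactly the
  traversals of the cycles of the undirected graph. Connectedness includes nonemptiness.
\<close>

definition undirected_tree :: "'a pair_pre_digraph \<Rightarrow> bool" where
  "undirected_tree T \<longleftrightarrow>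
     pair_graph T \<and> Digraph_Component.connected (with_proj T) \<and>
     \<not> (\<exists>p. pre_digraph.cycle (with_proj T) p \<and> 3 \<le> length p)"

text \<open>
  The condition \<open>pair_graph H\<close> makes \<open>H\<close> an undirected graph; the library's \<open>subgraph\<close> alone would
  allow keeping only one of the two arcs of an edge.
\<close>

definition subtrees :: "'a pair_pre_digraph \<Rightarrow> 'a pair_pre_digraph set" where
  "subtrees T =
     {H. pair_graph H \<and> subgraph (with_proj H) (with_proj T) \<and>
         Digraph_Component.connected (with_proj H)}"

definition num_subtrees :: "'a pair_pre_digraph \<Rightarrow> nat \<Rightarrow> nat" where
  "num_subtrees T k = card {H \<in> subtrees T. card (pverts H) = k}"

definition subtree_poly :: "'a pair_pre_digraph \<Rightarrow> complex poly" where
  "subtree_poly T = (\<Sum>k = 1..card (pverts T). monom (of_nat (num_subtrees T k)) k)"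

definition subtree_roots :: "'a pair_pre_digraph \<Rightarrow> complex set" where
  "subtree_roots T = {z. poly (subtree_poly T) z = 0}"

text \<open>The star \<open>K\<^bsub>1,n-1\<^esub>\<close> of order \<open>n \<ge> 1\<close> on the vertices \<open>0, \<dots>, n - 1\<close>, with centre \<open>0\<close>.\<close>

definition star_graph :: "nat \<Rightarrow> nat pair_pre_digraph" where
  "star_graph n = \<lparr> pverts = {..<n}, parcs = {0} \<times> {1..<n} \<union> {1..<n} \<times> {0} \<rparr>"

end

theory Submission
  imports Defs
begin

text \<open>
  Fix a root \<open>v\<close> of a tree \<open>T\<close> with subtree polynomial \<open>\<Phi>\<close>, and let \<open>\<phi>\<close> be the part of \<open>\<Phi>\<close>
  that counts the subtrees containing \<open>v\<close>. Removing an edge \<open>vu\<close> leaves a tree \<open>A\<close> rooted at \<open>v\<close>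
  and a tree \<open>B\<close> rooted at \<open>u\<close>. A subtree of \<open>T\<close> lies in \<open>A\<close>, lies in \<open>B\<close>, or uses the edge and
  is then a subtree of \<open>A\<close> through \<open>v\<close> glued to a subtree of \<open>B\<close> through \<open>u\<close>. Hence
  \<open>\<Phi> = \<Phi>\<^sub>A + \<Phi>\<^sub>B + \<phi>\<^sub>A \<phi>\<^sub>B\<close> and \<open>\<phi> = \<phi>\<^sub>A (1 + \<phi>\<^sub>B)\<close>
  (\<open>sub_poly_join\<close>, \<open>rooted_poly_join\<close>).

  Write \<open>|z| = 1 + s\<close> with \<open>s \<ge> 1\<close>. Induction along these recursions (\<open>tree_bounds\<close>) gives for a tree
  of order \<open>n\<close> both \<open>|\<phi>| \<ge> (1 + s) s\<^bsup>n-1\<^esup>\<close> and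
  \<open>|\<phi>| - |\<Phi> - \<phi>| \<ge> (1 + s) (s\<^bsup>n-1\<^esup> - (n - 1))\<close>. Stars with \<open>n\<close> even attain the second bound at
  \<open>z = - 1 - s\<close>, whichever vertex is the root, so this is the right inequality to induct on. If
  \<open>s\<^bsup>n-1\<^esup> > n - 1\<close>, then \<open>|\<phi>| > |\<Phi> - \<phi>|\<close> and \<open>z\<close> is not a root; this is the disk.

  For the boundary let \<open>s\<^bsup>n-1\<^esup> = n - 1\<close>. The induction step has the slack
  \<open>(1 + s) (s\<^bsup>a-1\<^esup> - 1) (s\<^bsup>b-1\<^esup> - 1)\<close>, where \<open>a\<close> and \<open>b\<close> are the orders of \<open>A\<close> and \<open>B\<close>. A root of
  absolute value \<open>1 + s\<close> forces it to vanish for every edge of \<open>T\<close>, as any edge can serve in the last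
  step. If \<open>n \<ge> 3\<close>, then \<open>s > 1\<close>, so every edge has an end of degree one; for \<open>n = 2\<close> this is
  trivial. A tree with this property is a star. The subtree polynomial of a star is
  \<open>z (1 + z)\<^bsup>n-1\<^esup> + (n - 1) z\<close>, and its roots on the circle can be read off.
\<close>

section \<open>Connected graphs and bridges\<close>

definition conn_graph :: "'a set \<Rightarrow> 'a rel \<Rightarrow> bool" where
  "conn_graph V E \<longleftrightarrow> finite V \<and> V \<noteq> {} \<and> E \<subseteq> V \<times> V \<and> sym E \<and> (\<forall>x\<in>V. \<forall>y\<in>V. (x, y) \<in> E\<^sup>*)"

definition is_bridge :: "'a rel \<Rightarrow> 'a \<Rightarrow> 'a \<Rightarrow> bool" where
  "is_bridge E x y \<longleftrightarrow> (x, y) \<notin> (E - {(x, y), (y, x)})\<^sup>*"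

text \<open>
  Of the tree property, only this consequence of acyclicity enters: every edge is the only
  connection between its ends. Unlike the absence of cycles, it needs no walks to state, and it
  passes to subgraphs by monotonicity of reachability.
\<close>

definition bridge_tree :: "'a set \<Rightarrow> 'a rel \<Rightarrow> bool" where
  "bridge_tree V E \<longleftrightarrow> conn_graph V E \<and> (\<forall>(x, y) \<in> E. is_bridge E x y)"

lemma is_bridge_mono: "is_bridge E x y \<Longrightarrow> F \<subseteq> E \<Longrightarrow> is_bridge F x y"
  unfolding is_bridge_def by (meson Diff_mono rtrancl_mono subsetD subset_refl)

lemma rtrancl_stays_inside:
  assumes "(x, y) \<in> R\<^sup>*" "x \<in> S" "\<And>a b. a \<in> S \<Longrightarrow> (a, b) \<in> R \<Longrightarrow> b \<in> S"
  shows "y \<in> S \<and> (x, y) \<in> (R \<inter> S \<times> S)\<^sup>*"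
  using assms(1)
proof (induction rule: rtrancl_induct)
  case base
  then show ?case using assms(2) by simp
next
  case (step y w)
  then have "w \<in> S" using assms(3) by blast
  moreover have "(y, w) \<in> R \<inter> S \<times> S" using step calculation by blast
  ultimately show ?case using step by (meson rtrancl.rtrancl_into_rtrancl)
qed

lemma conn_graphI:
  assumes "finite V" "E \<subseteq> V \<times> V" "sym E" "v \<in> V" "\<And>x. x \<in> V \<Longrightarrow> (v, x) \<in> E\<^sup>*"
  shows "conn_graph V E"
proof -
  have "(x, y) \<in> E\<^sup>*" if "x \<in> V" "y \<in> V" for x y
  proof (rule rtrancl_trans)
    show "(x, v) \<in> E\<^sup>*" using assms(5)[OF that(1)] sym_rtrancl[OF assms(3)] by (rule symD[rotated])
    show "(v, y) \<in> E\<^sup>*" using assms(5)[OF that(2)] .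
  qed
  then show ?thesis using assms(1-4) by (auto simp: conn_graph_def)
qed

lemma conn_graph_component:
  assumes V: "finite V" "E \<subseteq> V \<times> V" "sym E" "v \<in> V"
    and A: "A = {x. (v, x) \<in> E\<^sup>*}"
  shows "conn_graph A (E \<inter> A \<times> A)"
proof (rule conn_graphI)
  have vA: "v \<in> A" by (simp add: A)
  then show "v \<in> A" .
  have "x \<in> V" if "(v, x) \<in> E\<^sup>*" for x
    using that by (induction rule: rtrancl_induct) (use V in auto)
  then show "finite A" using V(1) finite_subset[of A V] by (auto simp: A)
  show "sym (E \<inter> A \<times> A)" using V(3) by (auto simp: sym_def)
  have closed: "b \<in> A" if "a \<in> A" "(a, b) \<in> E" for a b
    using that unfolding A by (simp add: rtrancl.rtrancl_into_rtrancl)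
  show "(v, x) \<in> (E \<inter> A \<times> A)\<^sup>*" if "x \<in> A" for x
  proof (rule rtrancl_stays_inside[THEN conjunct2])
    show "(v, x) \<in> E\<^sup>*" using that by (simp add: A)
  qed (use vA closed in auto)
qed simp

text \<open>
  Two disjoint connected graphs, with one edge \<open>vu\<close> added between them. The sides need not be
  trees, so that a connected subgraph through the edge is again an instance.
\<close>

locale bridge_join =
  fixes A :: "'a set" and EA :: "'a rel" and v :: 'a
    and B :: "'a set" and EB :: "'a rel" and u :: 'a
  assumes conn_A: "conn_graph A EA" and conn_B: "conn_graph B EB"
    and disj: "A \<inter> B = {}" and v_in: "v \<in> A" and u_in: "u \<in> B"
begin

definition join_verts where "join_verts = A \<union> B"

definition join_edges where "join_edges = EA \<union> EB \<union> {(v, u), (u, v)}"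

lemma arcs_inside: "EA \<subseteq> A \<times> A" "EB \<subseteq> B \<times> B"
  using conn_A conn_B by (auto simp: conn_graph_def)

lemma finite_parts: "finite A" "finite B"
  using conn_A conn_B by (auto simp: conn_graph_def)

lemma card_join_verts: "card join_verts = card A + card B"
  unfolding join_verts_def using finite_parts disj by (simp add: card_Un_disjoint)

lemma stays_in_A: "(v, x) \<in> (EA \<union> EB)\<^sup>* \<Longrightarrow> x \<in> A"
  using rtrancl_stays_inside[of v x "EA \<union> EB" A] v_in arcs_inside disj by blast

lemma stays_in_B: "(u, x) \<in> (EA \<union> EB)\<^sup>* \<Longrightarrow> x \<in> B"
  using rtrancl_stays_inside[of u x "EA \<union> EB" B] u_in arcs_inside disj by blast

lemma conn_join: "conn_graph join_verts join_edges"
proof (rule conn_graphI)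
  show "finite join_verts" "join_edges \<subseteq> join_verts \<times> join_verts" "v \<in> join_verts"
    using finite_parts arcs_inside v_in u_in by (auto simp: join_verts_def join_edges_def)
  show "sym join_edges"
    using conn_A conn_B by (auto simp: conn_graph_def join_edges_def sym_def)
  have EA: "EA\<^sup>* \<subseteq> join_edges\<^sup>*" and EB: "EB\<^sup>* \<subseteq> join_edges\<^sup>*"
    by (auto intro!: rtrancl_mono simp: join_edges_def)
  show "(v, x) \<in> join_edges\<^sup>*" if "x \<in> join_verts" for x
  proof (cases "x \<in> A")
    case True
    then have "(v, x) \<in> EA\<^sup>*" using conn_A v_in by (simp add: conn_graph_def)
    then show ?thesis using EA by (rule rev_subsetD)
  next
    case False
    then have "(u, x) \<in> EB\<^sup>*"
      using that conn_B u_in by (simp add: conn_graph_def join_verts_def)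
    then have "(u, x) \<in> join_edges\<^sup>*" using EB by (rule rev_subsetD)
    moreover have "(v, u) \<in> join_edges" by (simp add: join_edges_def)
    ultimately show ?thesis by (rule converse_rtrancl_into_rtrancl[rotated])
  qed
qed

end

text \<open>
  The two sides are the components of the ends of the bridge after its removal.
\<close>

lemma bridge_split:
  assumes conn: "conn_graph V E" and e: "(v, u) \<in> E" and br: "is_bridge E v u"
  obtains A EA B EB where "bridge_join A EA v B EB u"
    "V = bridge_join.join_verts A B" "E = bridge_join.join_edges EA v EB u"
proof -
  define E' where "E' = E - {(v, u), (u, v)}"
  define A where "A = {x. (v, x) \<in> E'\<^sup>*}"
  define B where "B = {x. (u, x) \<in> E'\<^sup>*}"
  have V: "finite V" "E \<subseteq> V \<times> V" "sym E" and reach: "\<And>x y. x \<in> V \<Longrightarrow> y \<in> V \<Longrightarrow> (x, y) \<in> E\<^sup>*"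
    using conn by (auto simp: conn_graph_def)
  have symE': "sym E'" using V(3) unfolding E'_def sym_def by blast
  have E'V: "E' \<subseteq> V \<times> V" using V by (auto simp: E'_def)
  have vu: "v \<in> V" "u \<in> V" using V e by auto
  have "(v, u) \<notin> E'\<^sup>*" using br by (simp add: is_bridge_def E'_def)
  then have disj: "A \<inter> B = {}"
    unfolding A_def B_def using symD[OF sym_rtrancl[OF symE']] rtrancl_trans by fast
  have closed: "y \<in> A" if "x \<in> A" "(x, y) \<in> E'" for x y
    using that unfolding A_def by (simp add: rtrancl.rtrancl_into_rtrancl)
  have closed': "y \<in> B" if "x \<in> B" "(x, y) \<in> E'" for x y
    using that unfolding B_def by (simp add: rtrancl.rtrancl_into_rtrancl)
  have vA: "v \<in> A" and uB: "u \<in> B" by (auto simp: A_def B_def)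
  have cover: "x \<in> A \<union> B" if "x \<in> V" for x
  proof -
    have "x \<in> A \<union> B \<and> (v, x) \<in> (E \<inter> (A \<union> B) \<times> (A \<union> B))\<^sup>*"
    proof (rule rtrancl_stays_inside)
      show "(v, x) \<in> E\<^sup>*" using reach that vu by blast
    next
      fix a b assume "a \<in> A \<union> B" "(a, b) \<in> E"
      then show "b \<in> A \<union> B"
        using closed closed' vA uB by (cases "(a, b) \<in> E'") (auto simp: E'_def)
    qed (use vA in simp)
    then show ?thesis by simp
  qed
  have "conn_graph A (E' \<inter> A \<times> A)" "conn_graph B (E' \<inter> B \<times> B)"
    by (rule conn_graph_component[OF V(1) E'V symE'], fact, simp add: A_def B_def)+
  then have J: "bridge_join A (E' \<inter> A \<times> A) v B (E' \<inter> B \<times> B) u"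
    using disj vA uB by unfold_locales auto
  have "A \<subseteq> V" "B \<subseteq> V"
    using rtrancl_stays_inside[of v _ E' V] rtrancl_stays_inside[of u _ E' V] vu E'V
    unfolding A_def B_def by blast+
  then have "V = A \<union> B" using cover by blast
  moreover have "E = (E' \<inter> A \<times> A) \<union> (E' \<inter> B \<times> B) \<union> {(v, u), (u, v)}"
  proof -
    have "(x, y) \<in> E' \<inter> A \<times> A \<union> E' \<inter> B \<times> B" if "(x, y) \<in> E'" for x y
    proof -
      have "x \<in> A \<union> B" using E'V that cover by blast
      then show ?thesis using closed closed' that by blast
    qed
    moreover have "(u, v) \<in> E" using e V(3) by (auto dest: symD)
    ultimately show ?thesis using e by (auto simp: E'_def)
  qed
  ultimately show ?thesis
    using that[OF J] by (simp add: bridge_join.join_verts_def[OF J] bridge_join.join_edges_def[OF J])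
qed

lemma bridge_tree_subgraph:
  assumes "bridge_tree V E" "conn_graph W F" "F \<subseteq> E"
  shows "bridge_tree W F"
  unfolding bridge_tree_def
proof (intro conjI ballI, fact, clarify)
  fix x y assume "(x, y) \<in> F"
  then have "is_bridge E x y" using assms(1,3) by (auto simp: bridge_tree_def)
  then show "is_bridge F x y" using assms(3) by (rule is_bridge_mono)
qed

section \<open>Counting connected subgraphs across a bridge\<close>

text \<open>
  Subgraphs are pairs of a vertex set and an arc set, not just vertex sets, to match the subtrees of
  the theorem directly; that subtrees of a tree are induced subgraphs then never has to be shown.
\<close>

definition conn_subgraphs :: "'a set \<Rightarrow> 'a rel \<Rightarrow> ('a set \<times> 'a rel) set" where
  "conn_subgraphs V E = {(W, F). W \<subseteq> V \<and> F \<subseteq> E \<and> conn_graph W F}"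

definition rooted_subgraphs :: "'a set \<Rightarrow> 'a rel \<Rightarrow> 'a \<Rightarrow> ('a set \<times> 'a rel) set" where
  "rooted_subgraphs V E r = {(W, F) \<in> conn_subgraphs V E. r \<in> W}"

definition sub_poly :: "'a set \<Rightarrow> 'a rel \<Rightarrow> complex \<Rightarrow> complex" where
  "sub_poly V E z = (\<Sum>(W, F) \<in> conn_subgraphs V E. z ^ card W)"

definition rooted_poly :: "'a set \<Rightarrow> 'a rel \<Rightarrow> 'a \<Rightarrow> complex \<Rightarrow> complex" where
  "rooted_poly V E r z = (\<Sum>(W, F) \<in> rooted_subgraphs V E r. z ^ card W)"

lemma finite_conn_subgraphs:
  assumes "finite V" "E \<subseteq> V \<times> V"
  shows "finite (conn_subgraphs V E)"
proof (rule finite_subset)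
  show "conn_subgraphs V E \<subseteq> Pow V \<times> Pow E" by (auto simp: conn_subgraphs_def)
  show "finite (Pow V \<times> Pow E)"
    using assms finite_subset by (metis finite_Pow_iff finite_SigmaI)
qed

lemma mem_rooted_subgraphs:
  "H \<in> rooted_subgraphs V E r \<longleftrightarrow> H \<in> conn_subgraphs V E \<and> r \<in> fst H"
  by (auto simp: rooted_subgraphs_def)

lemma rooted_subset: "rooted_subgraphs V E r \<subseteq> conn_subgraphs V E"
  by (auto simp: rooted_subgraphs_def)

context bridge_join
begin

definition glue :: "('a set \<times> 'a rel) \<times> ('a set \<times> 'a rel) \<Rightarrow> 'a set \<times> 'a rel" where
  "glue = (\<lambda>((W1, F1), (W2, F2)). (W1 \<union> W2, F1 \<union> F2 \<union> {(v, u), (u, v)}))"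

definition glued :: "('a set \<times> 'a rel) set" where
  "glued = glue ` (rooted_subgraphs A EA v \<times> rooted_subgraphs B EB u)"

lemma inj_glue:
  "inj_on glue (rooted_subgraphs A EA v \<times> rooted_subgraphs B EB u)"
proof (rule inj_on_inverseI)
  fix p assume "p \<in> rooted_subgraphs A EA v \<times> rooted_subgraphs B EB u"
  then obtain W1 F1 W2 F2 where p: "p = ((W1, F1), (W2, F2))"
    and W: "W1 \<subseteq> A" "W2 \<subseteq> B" and F: "F1 \<subseteq> A \<times> A" "F2 \<subseteq> B \<times> B"
    using arcs_inside by (auto simp: rooted_subgraphs_def conn_subgraphs_def)
  have "(W1 \<union> W2) \<inter> A = W1" "(W1 \<union> W2) \<inter> B = W2" using W disj by blast+
  moreover have "(F1 \<union> F2 \<union> {(v, u), (u, v)}) \<inter> A \<times> A = F1"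
    "(F1 \<union> F2 \<union> {(v, u), (u, v)}) \<inter> B \<times> B = F2"
    using F disj v_in u_in by blast+
  \<comment> \<open>A glued subgraph is cut back into its parts by restriction to the two sides.\<close>
  ultimately show "(\<lambda>(W, F). ((W \<inter> A, F \<inter> A \<times> A), (W \<inter> B, F \<inter> B \<times> B))) (glue p) = p"
    by (simp add: p glue_def)
qed

lemma glue_in:
  assumes "(W1, F1) \<in> rooted_subgraphs A EA v" "(W2, F2) \<in> rooted_subgraphs B EB u"
  shows "glue ((W1, F1), (W2, F2)) \<in> conn_subgraphs join_verts join_edges"
proof -
  have J: "bridge_join W1 F1 v W2 F2 u"
    using assms disj by unfold_locales (auto simp: rooted_subgraphs_def conn_subgraphs_def)
  show ?thesis
    using bridge_join.conn_join[OF J] assms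
    unfolding bridge_join.join_verts_def[OF J] bridge_join.join_edges_def[OF J]
    by (auto simp: conn_subgraphs_def rooted_subgraphs_def glue_def join_verts_def join_edges_def)
qed

text \<open>
  A connected subgraph containing the bridge is itself split by the bridge, into one connected
  subgraph of either side.
\<close>

lemma conn_subgraph_with_bridge:
  assumes WF: "(W, F) \<in> conn_subgraphs join_verts join_edges" and e: "(v, u) \<in> F"
  shows "(W, F) \<in> glued"
proof -
  have conn: "conn_graph W F" and W: "W \<subseteq> join_verts" and F: "F \<subseteq> join_edges"
    using WF by (auto simp: conn_subgraphs_def)
  have rest: "F - {(v, u), (u, v)} \<subseteq> EA \<union> EB" using F by (auto simp: join_edges_def)
  have "(v, u) \<notin> (EA \<union> EB)\<^sup>*" using stays_in_A u_in disj by blast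
  then have "is_bridge F v u"
    unfolding is_bridge_def using rtrancl_mono[OF rest] by blast
  then obtain C EC D ED where J: "bridge_join C EC v D ED u"
    and WV: "W = bridge_join.join_verts C D" and FE: "F = bridge_join.join_edges EC v ED u"
    using bridge_split[OF conn e] by metis
  interpret J: bridge_join C EC v D ED u by fact
  have WV: "W = C \<union> D" and FE: "F = EC \<union> ED \<union> {(v, u), (u, v)}"
    using WV FE by (auto simp: J.join_verts_def J.join_edges_def)
  have noe: "EC \<subseteq> F - {(v, u), (u, v)}" "ED \<subseteq> F - {(v, u), (u, v)}"
    using FE J.arcs_inside J.disj J.v_in J.u_in by blast+
  have C: "C \<subseteq> A"
  proof
    fix x assume "x \<in> C"
    then have "(v, x) \<in> EC\<^sup>*" using J.conn_A J.v_in by (auto simp: conn_graph_def)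
    then show "x \<in> A" using stays_in_A rtrancl_mono[of EC "EA \<union> EB"] noe rest by blast
  qed
  have D: "D \<subseteq> B"
  proof
    fix x assume "x \<in> D"
    then have "(u, x) \<in> ED\<^sup>*" using J.conn_B J.u_in by (auto simp: conn_graph_def)
    then show "x \<in> B" using stays_in_B rtrancl_mono[of ED "EA \<union> EB"] noe rest by blast
  qed
  have "EC \<subseteq> EA" "ED \<subseteq> EB"
    using noe rest J.arcs_inside C D arcs_inside disj by blast+
  then have "((C, EC), (D, ED)) \<in> rooted_subgraphs A EA v \<times> rooted_subgraphs B EB u"
    using C D J.conn_A J.conn_B J.v_in J.u_in by (auto simp: rooted_subgraphs_def conn_subgraphs_def)
  moreover have "(W, F) = glue ((C, EC), (D, ED))" by (simp add: glue_def WV FE)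
  ultimately show ?thesis unfolding glued_def by blast
qed

lemma conn_subgraph_without_bridge:
  assumes WF: "(W, F) \<in> conn_subgraphs join_verts join_edges" and e: "(v, u) \<notin> F"
  shows "(W, F) \<in> conn_subgraphs A EA \<union> conn_subgraphs B EB"
proof -
  have conn: "conn_graph W F" and W: "W \<subseteq> join_verts" and F: "F \<subseteq> join_edges"
    using WF by (auto simp: conn_subgraphs_def)
  have symF: "sym F" and FW: "F \<subseteq> W \<times> W" using conn by (auto simp: conn_graph_def)
  then have "(u, v) \<notin> F" using e by (auto dest: symD)
  then have sub: "F \<subseteq> EA \<union> EB" using F e by (auto simp: join_edges_def)
  obtain w where w: "w \<in> W" using conn by (auto simp: conn_graph_def)
  have reach: "(w, x) \<in> F\<^sup>*" if "x \<in> W" for x using conn w that by (auto simp: conn_graph_def)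
  show ?thesis
  proof (cases "w \<in> A")
    case True
    have "W \<subseteq> A"
      using rtrancl_stays_inside[OF reach True] sub arcs_inside disj by blast
    moreover have "F \<subseteq> EA" using sub FW calculation arcs_inside disj by blast
    ultimately show ?thesis using conn by (auto simp: conn_subgraphs_def)
  next
    case False
    then have wB: "w \<in> B" using w W by (auto simp: join_verts_def)
    have "W \<subseteq> B"
      using rtrancl_stays_inside[OF reach wB] sub arcs_inside disj by blast
    moreover have "F \<subseteq> EB" using sub FW calculation arcs_inside disj by blast
    ultimately show ?thesis using conn by (auto simp: conn_subgraphs_def)
  qed
qed

lemma conn_subgraphs_join:
  "conn_subgraphs join_verts join_edges = conn_subgraphs A EA \<union> conn_subgraphs B EB \<union>
     glued" (is "?L = ?R")
proof
  show "?L \<subseteq> ?R"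
  proof
    fix H assume H: "H \<in> ?L"
    obtain W F where WF: "H = (W, F)" by (cases H)
    show "H \<in> ?R"
      using conn_subgraph_with_bridge[of W F] conn_subgraph_without_bridge[of W F] H
      unfolding WF by blast
  qed
  have "conn_subgraphs A EA \<subseteq> ?L" "conn_subgraphs B EB \<subseteq> ?L"
    by (auto simp: conn_subgraphs_def join_verts_def join_edges_def)
  moreover have "glued \<subseteq> ?L"
    unfolding glued_def
  proof (rule image_subsetI)
    fix p assume "p \<in> rooted_subgraphs A EA v \<times> rooted_subgraphs B EB u"
    then show "glue p \<in> ?L" using glue_in by (metis SigmaE surj_pair)
  qed
  ultimately show "?R \<subseteq> ?L" by (intro Un_least)
qed

lemma sum_glue:
  fixes z :: complex
  shows "(\<Sum>(W, F) \<in> glued. z ^ card W) =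
    rooted_poly A EA v z * rooted_poly B EB u z"
proof -
  have "(\<Sum>(W, F) \<in> glued. z ^ card W) =
    (\<Sum>p \<in> rooted_subgraphs A EA v \<times> rooted_subgraphs B EB u. z ^ card (fst (glue p)))"
    unfolding glued_def by (simp add: sum.reindex[OF inj_glue] case_prod_unfold)
  also have "\<dots> = (\<Sum>(p, q) \<in> rooted_subgraphs A EA v \<times> rooted_subgraphs B EB u.
      z ^ card (fst p) * z ^ card (fst q))"
  proof (rule sum.cong[OF refl])
    fix p assume "p \<in> rooted_subgraphs A EA v \<times> rooted_subgraphs B EB u"
    then obtain W1 F1 W2 F2 where p: "p = ((W1, F1), (W2, F2))"
      and W: "W1 \<subseteq> A" "W2 \<subseteq> B"
      by (auto simp: rooted_subgraphs_def conn_subgraphs_def)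
    have "card (W1 \<union> W2) = card W1 + card W2"
      using W disj finite_parts by (intro card_Un_disjoint) (auto intro: finite_subset)
    then show "z ^ card (fst (glue p)) = (case p of (p, q) \<Rightarrow> z ^ card (fst p) * z ^ card (fst q))"
      by (simp add: p glue_def power_add)
  qed
  also have "\<dots> = rooted_poly A EA v z * rooted_poly B EB u z"
    by (simp add: rooted_poly_def sum_product sum.cartesian_product case_prod_unfold)
  finally show ?thesis .
qed

lemma finite_join_parts:
  "finite (conn_subgraphs A EA)" "finite (conn_subgraphs B EB)"
  "finite (glued)"
proof -
  show *: "finite (conn_subgraphs A EA)" "finite (conn_subgraphs B EB)"
    using finite_parts arcs_inside finite_conn_subgraphs by blast+
  show "finite glued"
    unfolding glued_def using *[THEN finite_subset[OF rooted_subset]] by simp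
qed

lemma glue_meets_both:
  "(W, F) \<in> glued \<Longrightarrow> v \<in> W \<and> u \<in> W"
  by (auto simp: glued_def glue_def rooted_subgraphs_def)

lemma disjoint_kinds:
  "conn_subgraphs A EA \<inter> conn_subgraphs B EB = {}"
  "conn_subgraphs A EA \<inter> glued = {}"
  "conn_subgraphs B EB \<inter> glued = {}"
proof -
  have a: "fst H \<subseteq> A \<and> fst H \<noteq> {}" if "H \<in> conn_subgraphs A EA" for H
    using that by (auto simp: conn_subgraphs_def conn_graph_def)
  have b: "fst H \<subseteq> B \<and> fst H \<noteq> {}" if "H \<in> conn_subgraphs B EB" for H
    using that by (auto simp: conn_subgraphs_def conn_graph_def)
  have g: "v \<in> fst H \<and> u \<in> fst H" if "H \<in> glued" for H
    using that glue_meets_both[of "fst H" "snd H"] by simp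
  show "conn_subgraphs A EA \<inter> conn_subgraphs B EB = {}"
    using a b disj by blast
  show "conn_subgraphs A EA \<inter> glued = {}"
    using a g u_in disj by blast
  show "conn_subgraphs B EB \<inter> glued = {}"
    using b g v_in disj by blast
qed

lemma sub_poly_join:
  "sub_poly join_verts join_edges z =
     sub_poly A EA z + sub_poly B EB z + rooted_poly A EA v z * rooted_poly B EB u z"
  unfolding sub_poly_def conn_subgraphs_join
  using finite_join_parts disjoint_kinds
  by (simp add: sum.union_disjoint Int_Un_distrib2 sum_glue)

lemma rooted_poly_join:
  "rooted_poly join_verts join_edges v z = rooted_poly A EA v z * (1 + rooted_poly B EB u z)"
proof -
  have "H \<in> rooted_subgraphs join_verts join_edges v \<longleftrightarrow> H \<in> rooted_subgraphs A EA v \<or> H \<in> glued" for H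
  proof -
    have "v \<notin> fst H" if "H \<in> conn_subgraphs B EB"
      using that v_in disj by (auto simp: conn_subgraphs_def)
    moreover have "v \<in> fst H" if "H \<in> glued"
      using that glue_meets_both[of "fst H" "snd H"] by simp
    ultimately show ?thesis
      unfolding mem_rooted_subgraphs conn_subgraphs_join Un_iff by blast
  qed
  then have "rooted_subgraphs join_verts join_edges v = rooted_subgraphs A EA v \<union> glued" by blast
  moreover have "rooted_subgraphs A EA v \<inter> glued = {}"
    using disjoint_kinds(2) rooted_subset[of A EA v] by blast
  moreover have "finite (rooted_subgraphs A EA v)"
    using finite_join_parts(1) by (rule finite_subset[OF rooted_subset])
  ultimately have "rooted_poly join_verts join_edges v z = rooted_poly A EA v z + (\<Sum>(W, F) \<in> glued. z ^ card W)"
    using finite_join_parts(3) unfolding rooted_poly_def by (simp add: sum.union_disjoint)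
  then show ?thesis by (simp add: sum_glue algebra_simps)
qed

end

lemma
  assumes "irrefl E" "E \<subseteq> {r} \<times> {r}"
  shows sub_poly_single: "sub_poly {r} E z = z"
    and rooted_poly_single: "rooted_poly {r} E r z = z"
proof -
  have "E = {}" using assms by (auto simp: irrefl_def)
  then have "conn_subgraphs {r} E = {({r}, {})}"
    by (auto simp: conn_subgraphs_def conn_graph_def sym_def)
  moreover from this have "rooted_subgraphs {r} E r = {({r}, {})}"
    by (auto simp: rooted_subgraphs_def)
  ultimately show "sub_poly {r} E z = z" "rooted_poly {r} E r z = z"
    by (simp_all add: sub_poly_def rooted_poly_def)
qed

section \<open>Lower bounds for the subtree polynomial of a tree\<close>

lemma bridge_tree_irrefl: "bridge_tree V E \<Longrightarrow> irrefl E"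
  by (auto simp: bridge_tree_def irrefl_def is_bridge_def)

text \<open>
  The estimate behind one step of the induction: \<open>p\<close> and \<open>q\<close> are the absolute values of the rooted
  polynomials of the two sides of an edge, \<open>(1 + s) x\<close> and \<open>(1 + s) y\<close> lower bounds for them.
  The difference of the two sides is \<open>(p - 2) (q - 2) - ((1 + s) x - 2) ((1 + s) y - 2)\<close>.
\<close>

lemma join_estimate:
  fixes s x y p q :: real
  assumes "1 \<le> s" "1 \<le> x" "1 \<le> y" "(1 + s) * x \<le> p" "(1 + s) * y \<le> q"
  shows "(1 + s) * (s * x * y + (x - 1) * (y - 1)) \<le> p * q - 2 * p - 2 * q + (1 + s) * (x + y + 1)"
proof -
  have "2 \<le> (1 + s) * x" "2 \<le> (1 + s) * y"
    using mult_mono[of 2 "1 + s" 1 x] mult_mono[of 2 "1 + s" 1 y] assms by auto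
  then have "((1 + s) * x - 2) * ((1 + s) * y - 2) \<le> (p - 2) * (q - 2)"
    using assms by (intro mult_mono) auto
  then show ?thesis by (simp add: algebra_simps)
qed

context bridge_join
begin

text \<open>
  The subtrees avoiding \<open>v\<close> lie in \<open>A\<close> and avoid \<open>v\<close>, or lie in \<open>B\<close>; the latter contain \<open>u\<close> or not.
\<close>

lemma norm_unrooted_join:
  "norm (sub_poly join_verts join_edges z - rooted_poly join_verts join_edges v z) \<le>
     norm (sub_poly A EA z - rooted_poly A EA v z) +
     (norm (rooted_poly B EB u z) + norm (sub_poly B EB z - rooted_poly B EB u z))"
proof -
  have "sub_poly join_verts join_edges z - rooted_poly join_verts join_edges v z =
    (sub_poly A EA z - rooted_poly A EA v z) +
    (rooted_poly B EB u z + (sub_poly B EB z - rooted_poly B EB u z))"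
    by (simp add: sub_poly_join rooted_poly_join algebra_simps)
  then show ?thesis by (metis norm_triangle_le add_left_mono norm_triangle_ineq)
qed

lemma norm_rooted_join:
  "norm (rooted_poly A EA v z) * (norm (rooted_poly B EB u z) - 1)
     \<le> norm (rooted_poly join_verts join_edges v z)"
  unfolding rooted_poly_join norm_mult
  using norm_diff_ineq[of "rooted_poly B EB u z" 1]
  by (intro mult_left_mono) (simp_all add: add.commute)

text \<open>
  The product term \<open>(x - 1) (y - 1)\<close> is the slack that decides the equality case.
\<close>

lemma join_bounds:
  fixes z :: complex and s :: real
  defines "x \<equiv> s ^ (card A - 1)" and "y \<equiv> s ^ (card B - 1)"
  assumes s: "1 \<le> s"
    and A: "(1 + s) * x \<le> norm (rooted_poly A EA v z)"
      "(1 + s) * (x - (real (card A) - 1)) \<le>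
        norm (rooted_poly A EA v z) - norm (sub_poly A EA z - rooted_poly A EA v z)"
    and B: "(1 + s) * y \<le> norm (rooted_poly B EB u z)"
      "(1 + s) * (y - (real (card B) - 1)) \<le>
        norm (rooted_poly B EB u z) - norm (sub_poly B EB z - rooted_poly B EB u z)"
  shows "(1 + s) * s ^ (card join_verts - 1) \<le> norm (rooted_poly join_verts join_edges v z)"
    and "(1 + s) * (s ^ (card join_verts - 1) - (real (card join_verts) - 1) + (x - 1) * (y - 1)) \<le>
        norm (rooted_poly join_verts join_edges v z) - norm (sub_poly join_verts join_edges z - rooted_poly join_verts join_edges v z)"
proof -
  let ?p = "norm (rooted_poly A EA v z)" and ?q = "norm (rooted_poly B EB u z)"
  have cards: "card A \<ge> 1" "card B \<ge> 1"
    using finite_parts v_in u_in by (auto simp: Suc_le_eq card_gt_0_iff)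
  have xy: "1 \<le> x" "1 \<le> y" using s by (auto simp: x_def y_def)
  have "card join_verts - 1 = Suc ((card A - 1) + (card B - 1))" using cards by (simp add: card_join_verts)
  then have pow: "s ^ (card join_verts - 1) = s * x * y" by (simp add: x_def y_def power_add)
  have "s * y \<le> (1 + s) * y - 1" using xy by (simp add: algebra_simps)
  then have "s * y \<le> ?q - 1" using B(1) by linarith
  then have "((1 + s) * x) * (s * y) \<le> ?p * (?q - 1)"
    using A(1) s xy by (intro mult_mono) auto
  then show "(1 + s) * s ^ (card join_verts - 1) \<le> norm (rooted_poly join_verts join_edges v z)"
    using norm_rooted_join[of z] unfolding pow by (simp add: mult_ac)
  have "(1 + s) * (s * x * y + (x - 1) * (y - 1)) \<le> ?p * ?q - 2 * ?p - 2 * ?q + (1 + s) * (x + y + 1)"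
    using join_estimate[OF s xy A(1) B(1)] .
  moreover have "real (card join_verts) = real (card A) + real (card B)" by (simp add: card_join_verts)
  ultimately show "(1 + s) * (s ^ (card join_verts - 1) - (real (card join_verts) - 1) + (x - 1) * (y - 1)) \<le>
        norm (rooted_poly join_verts join_edges v z) - norm (sub_poly join_verts join_edges z - rooted_poly join_verts join_edges v z)"
    using norm_rooted_join[of z] norm_unrooted_join[of z] A(2) B(2) unfolding pow
    by (simp add: algebra_simps)
qed

end

lemma card_le_1_singleton:
  assumes "finite V" "r \<in> V" "card V \<le> 1"
  shows "V = {r}"
  using assms card_le_Suc0_iff_eq[of V] by auto

lemma conn_graph_has_neighbour:
  assumes "conn_graph V E" "r \<in> V" "V \<noteq> {r}"
  obtains u where "(r, u) \<in> E"
proof -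
  obtain w where "w \<in> V" "w \<noteq> r" using assms by blast
  then have "(r, w) \<in> E\<^sup>*" using assms by (simp add: conn_graph_def)
  then show ?thesis using \<open>w \<noteq> r\<close> that by (metis converse_rtranclE)
qed

lemma bridge_tree_split:
  assumes T: "bridge_tree V E" and e: "(v, u) \<in> E"
  obtains A EA B EB where "bridge_join A EA v B EB u"
    "V = bridge_join.join_verts A B" "E = bridge_join.join_edges EA v EB u"
    "bridge_tree A EA" "bridge_tree B EB"
proof -
  have "conn_graph V E" "is_bridge E v u" using assms by (auto simp: bridge_tree_def)
  then obtain A EA B EB where J: "bridge_join A EA v B EB u"
    "V = bridge_join.join_verts A B" and E: "E = bridge_join.join_edges EA v EB u"
    using e by (metis bridge_split)
  have "EA \<subseteq> E" "EB \<subseteq> E" by (auto simp: E bridge_join.join_edges_def[OF J(1)])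
  then show ?thesis
    using that[OF J E] bridge_tree_subgraph[OF T]
      bridge_join.conn_A[OF J(1)] bridge_join.conn_B[OF J(1)] by blast
qed

lemma tree_bounds:
  fixes z :: complex and s :: real
  assumes "bridge_tree V E" "r \<in> V" and s: "1 \<le> s" and z: "norm z = 1 + s"
  shows "(1 + s) * s ^ (card V - 1) \<le> norm (rooted_poly V E r z) \<and>
    (1 + s) * (s ^ (card V - 1) - (real (card V) - 1)) \<le>
      norm (rooted_poly V E r z) - norm (sub_poly V E z - rooted_poly V E r z)"
  using assms(1,2)
proof (induction "card V" arbitrary: V E r rule: less_induct)
  case less
  have conn: "conn_graph V E" using less.prems by (simp add: bridge_tree_def)
  show ?case
  proof (cases "V = {r}")
    case True
    then have "E \<subseteq> {r} \<times> {r}" using conn by (simp add: conn_graph_def)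
    then have "sub_poly V E z = z" "rooted_poly V E r z = z"
      using sub_poly_single[of E r] rooted_poly_single[of E r] bridge_tree_irrefl[OF less.prems(1)] True
      by simp_all
    then show ?thesis using z True by simp
  next
    case False
    then obtain u where e: "(r, u) \<in> E"
      using conn_graph_has_neighbour[OF conn less.prems(2)] by blast
    obtain A EA B EB where J: "bridge_join A EA r B EB u"
      and V: "V = bridge_join.join_verts A B" and E: "E = bridge_join.join_edges EA r EB u"
      and TA: "bridge_tree A EA" and TB: "bridge_tree B EB"
      using bridge_tree_split[OF less.prems(1) e] by metis
    interpret bridge_join A EA r B EB u by fact
    have cards: "card A \<ge> 1" "card B \<ge> 1"
      using finite_parts v_in u_in by (auto simp: Suc_le_eq card_gt_0_iff)
    then have "card A < card V" "card B < card V" using V card_join_verts by simp_all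
    then have IH: "(1 + s) * s ^ (card A - 1) \<le> norm (rooted_poly A EA r z) \<and>
        (1 + s) * (s ^ (card A - 1) - (real (card A) - 1)) \<le>
          norm (rooted_poly A EA r z) - norm (sub_poly A EA z - rooted_poly A EA r z)"
      "(1 + s) * s ^ (card B - 1) \<le> norm (rooted_poly B EB u z) \<and>
        (1 + s) * (s ^ (card B - 1) - (real (card B) - 1)) \<le>
          norm (rooted_poly B EB u z) - norm (sub_poly B EB z - rooted_poly B EB u z)"
      using less.hyps TA TB v_in u_in by blast+
    have "0 \<le> (1 + s) * ((s ^ (card A - 1) - 1) * (s ^ (card B - 1) - 1))"
      using s by (intro mult_nonneg_nonneg) auto
    then show ?thesis
      using join_bounds[of s z] IH s unfolding V E by (simp add: algebra_simps)
  qed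
qed

lemma sub_poly_nonzero:
  fixes z :: complex and s :: real
  assumes T: "bridge_tree V E" and s: "1 \<le> s" and z: "norm z = 1 + s"
    and n: "real (card V - 1) < s ^ (card V - 1)"
  shows "sub_poly V E z \<noteq> 0"
proof
  assume 0: "sub_poly V E z = 0"
  have conn: "conn_graph V E" using T by (simp add: bridge_tree_def)
  then obtain r where r: "r \<in> V" by (auto simp: conn_graph_def)
  have "card V \<ge> 1" using conn by (auto simp: conn_graph_def Suc_le_eq card_gt_0_iff)
  moreover have "(1 + s) * (s ^ (card V - 1) - (real (card V) - 1)) \<le> 0"
    using tree_bounds[OF T r s z] 0 by simp
  ultimately show False using n s by (simp add: mult_le_0_iff)
qed

section \<open>Equality forces a star\<close>

definition is_star :: "'a set \<Rightarrow> 'a rel \<Rightarrow> 'a \<Rightarrow> bool" where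
  "is_star V E c \<longleftrightarrow> c \<in> V \<and> E = {c} \<times> (V - {c}) \<union> (V - {c}) \<times> {c}"

text \<open>
  The given edge is taken as the first one to be removed: a zero makes the left side of the second
  bound of \<open>join_bounds\<close> nonpositive, and there the main term cancels. For order 2 the
  assumptions give \<open>s = 1\<close> and the slack says nothing, but then both sides are single vertices anyway.
\<close>

lemma boundary_zero_edge:
  fixes z :: complex and s :: real
  assumes T: "bridge_tree V E" and s: "1 \<le> s" and z: "norm z = 1 + s"
    and n: "s ^ (card V - 1) = real (card V - 1)" and 0: "sub_poly V E z = 0"
    and e: "(v, u) \<in> E"
  shows "(\<forall>w. (v, w) \<in> E \<longrightarrow> w = u) \<or> (\<forall>w. (u, w) \<in> E \<longrightarrow> w = v)"
proof -
  obtain A EA B EB where J: "bridge_join A EA v B EB u"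
    and V: "V = bridge_join.join_verts A B" and E: "E = bridge_join.join_edges EA v EB u"
    and TA: "bridge_tree A EA" and TB: "bridge_tree B EB"
    using bridge_tree_split[OF T e] by metis
  interpret bridge_join A EA v B EB u by fact
  have cards: "card A \<ge> 1" "card B \<ge> 1"
    using finite_parts v_in u_in by (auto simp: Suc_le_eq card_gt_0_iff)
  have n1: "real (card V - 1) = real (card V) - 1" using cards V card_join_verts by simp
  have "(1 + s) * ((s ^ (card A - 1) - 1) * (s ^ (card B - 1) - 1)) \<le> 0"
    using join_bounds(2)[of s z] tree_bounds[OF TA v_in s z] tree_bounds[OF TB u_in s z] s 0 n n1
    unfolding V E by simp
  then have le: "(s ^ (card A - 1) - 1) * (s ^ (card B - 1) - 1) \<le> 0"
    using s by (simp add: mult_le_0_iff)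
  have "card A \<le> 1 \<or> card B \<le> 1"
  proof (rule ccontr)
    assume "\<not> ?thesis"
    then have big: "card A > 1" "card B > 1" by auto
    then have "s ^ (card V - 1) > 1" using n V card_join_verts by simp
    then have "s > 1" using s by (metis less_eq_real_def power_one)
    then have "s ^ (card A - 1) > 1" "s ^ (card B - 1) > 1" using big by (auto intro: one_less_power)
    then have "(s ^ (card A - 1) - 1) * (s ^ (card B - 1) - 1) > 0" by simp
    then show False using le by linarith
  qed
  then have "A = {v} \<or> B = {u}"
    using card_le_1_singleton finite_parts v_in u_in by metis
  moreover have "irrefl EA" "irrefl EB" using TA TB bridge_tree_irrefl by blast+
  ultimately have "EA = {} \<or> EB = {}" using arcs_inside by (fastforce simp: irrefl_def)
  then show ?thesis using arcs_inside v_in u_in disj unfolding E join_edges_def by blast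
qed

text \<open>
  Any edge has the form \<open>cu\<close> with \<open>u\<close> a leaf. A neighbour \<open>w\<close> of \<open>c\<close> that is not a leaf would be
  the only neighbour of \<open>c\<close> and hence equal to the leaf \<open>u\<close>. So all neighbours of \<open>c\<close> are
  leaves, and no vertex lies beyond them.
\<close>

lemma leaf_edges_imp_star:
  assumes conn: "conn_graph V E" and irr: "irrefl E" and n: "card V \<ge> 2"
    and leaf: "\<And>v u. (v, u) \<in> E \<Longrightarrow> (\<forall>w. (v, w) \<in> E \<longrightarrow> w = u) \<or> (\<forall>w. (u, w) \<in> E \<longrightarrow> w = v)"
  obtains c where "is_star V E c"
proof -
  have symE: "sym E" and EV: "E \<subseteq> V \<times> V" using conn by (auto simp: conn_graph_def)
  obtain r where "r \<in> V" using conn by (auto simp: conn_graph_def)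
  moreover have "V \<noteq> {r}" using n by auto
  ultimately obtain a where "(r, a) \<in> E" using conn_graph_has_neighbour[OF conn] by metis
  then obtain c u where e: "(c, u) \<in> E" and u: "\<forall>w. (u, w) \<in> E \<longrightarrow> w = c"
    using leaf symE by (metis symD)
  have leaves: "\<forall>x. (w, x) \<in> E \<longrightarrow> x = c" if "(c, w) \<in> E" for w
    using leaf[OF that] e u by metis
  have cV: "c \<in> V" using e EV by auto
  have spokes: "(c, w) \<in> E" if "w \<in> V" "w \<noteq> c" for w
  proof -
    have "(c, w) \<in> E\<^sup>*" using conn cV that by (simp add: conn_graph_def)
    then have "w = c \<or> (c, w) \<in> E"
      by (induction rule: rtrancl_induct) (use leaves in blast)+
    then show ?thesis using that by simp
  qed
  have "E = {c} \<times> (V - {c}) \<union> (V - {c}) \<times> {c}"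
  proof
    show "E \<subseteq> {c} \<times> (V - {c}) \<union> (V - {c}) \<times> {c}"
    proof (rule subrelI)
      fix x y assume xy: "(x, y) \<in> E"
      then have "x \<in> V" "y \<in> V" "x \<noteq> y" using EV irr by (auto simp: irrefl_def)
      then show "(x, y) \<in> {c} \<times> (V - {c}) \<union> (V - {c}) \<times> {c}"
        using leaves spokes xy by blast
    qed
    show "{c} \<times> (V - {c}) \<union> (V - {c}) \<times> {c} \<subseteq> E"
      using spokes symE by (auto dest: symD)
  qed
  then show ?thesis using that cV by (auto simp: is_star_def)
qed

section \<open>The subtree polynomial of a star\<close>

text \<open>
  A star grows by joining a single vertex to its centre.
\<close>

lemma star_poly:
  assumes "is_star V E c" "finite V" "card V = Suc m"
  shows "rooted_poly V E c z = z * (1 + z) ^ m \<and>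
    sub_poly V E z = z * (1 + z) ^ m + of_nat m * z"
  using assms
proof (induction m arbitrary: V E)
  case 0
  then have "V = {c}" using card_le_1_singleton[of V c] by (simp add: is_star_def)
  moreover from this have "E = {}" using 0 by (simp add: is_star_def)
  ultimately show ?case
    by (simp add: sub_poly_single rooted_poly_single irrefl_def)
next
  case (Suc m)
  have cV: "c \<in> V" and E: "E = {c} \<times> (V - {c}) \<union> (V - {c}) \<times> {c}"
    using Suc.prems by (auto simp: is_star_def)
  have "V \<noteq> {c}" using Suc.prems by auto
  then obtain u where u: "u \<in> V" "u \<noteq> c" using cV by blast
  define A where "A = V - {u}"
  define EA where "EA = {c} \<times> (A - {c}) \<union> (A - {c}) \<times> {c}"
  have star: "is_star A EA c" using cV u by (auto simp: is_star_def A_def EA_def)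
  have A: "finite A" "card A = Suc m" using Suc.prems u by (auto simp: A_def)
  have "conn_graph A EA"
    using A(1) star by (intro conn_graphI[of _ _ c]) (auto simp: is_star_def sym_def)
  moreover have "conn_graph {u} {}" by (auto simp: conn_graph_def sym_def)
  ultimately have J: "bridge_join A EA c {u} {} u"
    using cV u by unfold_locales (auto simp: A_def)
  interpret bridge_join A EA c "{u}" "{}" u by fact
  have "join_verts = V" using u unfolding join_verts_def by (auto simp: A_def)
  moreover have "join_edges = E" using u cV unfolding join_edges_def by (auto simp: E EA_def A_def)
  moreover have "rooted_poly {u} {} u z = z" "sub_poly {u} {} z = z"
    by (simp_all add: sub_poly_single rooted_poly_single irrefl_def)
  ultimately show ?case
    using sub_poly_join[of z] rooted_poly_join[of z] Suc.IH[OF star A]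
    by (simp add: algebra_simps)
qed

text \<open>
  A nonzero root satisfies \<open>(1 + z)\<^sup>m = - m\<close>, so \<open>1 + z\<close> lies on the circle of radius \<open>r\<close> about
  \<open>0\<close>; the only point \<open>w\<close> of that circle with \<open>|w - 1| = 1 + r\<close> is \<open>- r\<close>.
\<close>

lemma star_boundary_root:
  fixes z :: complex
  assumes m: "m \<ge> 1" and r: "r \<ge> 1" "r ^ m = real m"
  shows "z * (1 + z) ^ m + of_nat m * z = 0 \<and> norm z = 1 + r \<longleftrightarrow>
    odd m \<and> z = complex_of_real (- 1 - r)"
proof
  assume L: "z * (1 + z) ^ m + of_nat m * z = 0 \<and> norm z = 1 + r"
  then have "z \<noteq> 0" using r by auto
  have "z * ((1 + z) ^ m + of_nat m) = 0" using L by (simp add: algebra_simps)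
  then have pw: "(1 + z) ^ m = - of_nat m" using \<open>z \<noteq> 0\<close> by (simp add: eq_neg_iff_add_eq_0)
  then have "norm (1 + z) ^ m = r ^ m" using r by (metis norm_power norm_minus_cancel norm_of_nat)
  then have "norm (1 + z) = r" using r m power_eq_iff_eq_base[of m "norm (1 + z)" r] by simp
  then have "(1 + Re z)\<^sup>2 + (Im z)\<^sup>2 = r\<^sup>2" by (metis cmod_power2 plus_complex.sel one_complex.sel add_0)
  moreover have "(Re z)\<^sup>2 + (Im z)\<^sup>2 = (1 + r)\<^sup>2" using L by (metis cmod_power2)
  ultimately have re: "Re z = - 1 - r" by (simp add: power2_eq_square algebra_simps)
  have "(Re z)\<^sup>2 = (1 + r)\<^sup>2" unfolding re by (simp add: power2_eq_square algebra_simps)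
  then have "Im z = 0" using \<open>(Re z)\<^sup>2 + (Im z)\<^sup>2 = (1 + r)\<^sup>2\<close> by simp
  then have z: "z = complex_of_real (- 1 - r)" using re by (simp add: complex_eq_iff)
  have "odd m"
  proof
    assume "even m"
    then have "(1 + z) ^ m = complex_of_real (r ^ m)" by (simp add: z flip: of_real_power)
    then have "complex_of_real (real m) = complex_of_real (- real m)" using pw r by simp
    then have "real m = - real m" by (simp only: of_real_eq_iff)
    then show False using m by simp
  qed
  then show "odd m \<and> z = complex_of_real (- 1 - r)" using z by blast
next
  assume R: "odd m \<and> z = complex_of_real (- 1 - r)"
  then have "(1 + z) ^ m = - complex_of_real (r ^ m)" by simp
  then have "(1 + z) ^ m = - of_nat m" using r by simp
  moreover have "norm z = 1 + r" using R r by (simp only: norm_of_real)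
  ultimately show "z * (1 + z) ^ m + of_nat m * z = 0 \<and> norm z = 1 + r" by simp
qed

section \<open>Undirected trees as symmetric relations\<close>

lemma pair_graph_iff:
  "pair_graph T \<longleftrightarrow> finite (pverts T) \<and> parcs T \<subseteq> pverts T \<times> pverts T \<and> sym (parcs T) \<and> irrefl (parcs T)"
  (is "_ \<longleftrightarrow> ?R")
proof
  assume "pair_graph T"
  then interpret pair_graph T .
  show ?R
    using pair_finite_verts in_arcsD1 in_arcsD2 pair_no_loops sym_arcs
    by (fastforce simp: irrefl_def symmetric_def)
next
  assume R: ?R
  then have "finite (parcs T)" by (meson finite_SigmaI finite_subset)
  then show "pair_graph T"
    using R by unfold_locales (auto simp: irrefl_def symmetric_def)
qed

lemma connected_iff_conn_graph:
  assumes "pair_graph T"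
  shows "Digraph_Component.connected (with_proj T) \<longleftrightarrow> conn_graph (pverts T) (parcs T)"
proof -
  interpret pair_graph T by fact
  have s: "finite (pverts T)" "parcs T \<subseteq> pverts T \<times> pverts T" "sym (parcs T)"
    using assms by (auto simp: pair_graph_iff)
  have "parcs (mk_symmetric (with_proj T)) = parcs T"
    using s(3) by (auto simp: parcs_mk_symmetric sym_def)
  then have "mk_symmetric (with_proj T) = T" by (simp add: mk_symmetric_def)
  then have "Digraph_Component.connected (with_proj T) \<longleftrightarrow> strongly_connected (with_proj T)"
    by (simp add: Digraph_Component.connected_def)
  then show ?thesis
    using s by (auto simp: strongly_connected_def conn_graph_def reachable_conv)
qed

text \<open>
  A path between the ends of an edge that avoids both of its arcs has length at least 2, and the
  arc back closes it to a cycle of length at least 3.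
\<close>

lemma undirected_tree_imp_bridge_tree:
  assumes "undirected_tree T"
  shows "bridge_tree (pverts T) (parcs T)"
proof -
  have "pair_graph T" using assms by (simp add: undirected_tree_def)
  then interpret pair_graph T .
  have s: "finite (pverts T)" "parcs T \<subseteq> pverts T \<times> pverts T" "sym (parcs T)" "irrefl (parcs T)"
    using \<open>pair_graph T\<close> by (auto simp: pair_graph_iff)
  have "is_bridge (parcs T) u v" if uv: "(u, v) \<in> parcs T" for u v
    unfolding is_bridge_def
  proof
    define E' where "E' = parcs T - {(u, v), (v, u)}"
    define T' where "T' = \<lparr> pverts = pverts T, parcs = E' \<rparr>"
    assume "(u, v) \<in> (parcs T - {(u, v), (v, u)})\<^sup>*"
    then have path: "(u, v) \<in> E'\<^sup>*" by (simp add: E'_def)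
    interpret T': pair_wf_digraph T'
      using s by unfold_locales (auto simp: T'_def E'_def)
    have uV: "u \<in> pverts T" "v \<in> pverts T" using s uv by auto
    have "u \<rightarrow>\<^sup>*\<^bsub>with_proj T'\<^esub> v"
      using path uV T'.reachable_conv[of u v] by (simp add: T'_def)
    then obtain p where p: "T'.apath u p v" using T'.reachable_apath by blast
    then have pE: "set p \<subseteq> E'" "pcas u p v" "distinct (pawalk_verts u p)"
      unfolding T'.apath_def T'.awalk_def by (auto simp: T'_def)
    have neq: "u \<noteq> v" using s uv by (auto simp: irrefl_def)
    have vu: "(v, u) \<in> parcs T" using s uv by (auto dest: symD)
    have "p \<noteq> []" using pE neq by auto
    moreover have "p \<noteq> [e]" for e
    proof
      assume "p = [e]"
      then have "e = (u, v)" using pE by (cases e) auto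
      then show False using pE \<open>p = [e]\<close> by (simp add: E'_def)
    qed
    ultimately have len: "2 \<le> length p" by (cases p; cases "tl p") auto
    have "awalk v ((v, u) # p) v"
      using pE vu uV by (auto simp: awalk_def E'_def)
    then have "cycle ((v, u) # p)" unfolding cycle_def using pE by auto
    then show False using assms len unfolding undirected_tree_def by force
  qed
  moreover have "conn_graph (pverts T) (parcs T)"
    using assms connected_iff_conn_graph[OF \<open>pair_graph T\<close>] by (simp add: undirected_tree_def)
  ultimately show ?thesis by (auto simp: bridge_tree_def)
qed

lemma subtrees_bij:
  assumes "pair_graph T"
  shows "bij_betw (\<lambda>H. (pverts H, parcs H)) (subtrees T) (conn_subgraphs (pverts T) (parcs T))"
proof (rule bij_betwI[where g = "\<lambda>(W, F). \<lparr> pverts = W, parcs = F \<rparr>"])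
  have wf: "wf_digraph (with_proj H)" if "pair_graph H" for H :: "'a pair_pre_digraph"
  proof -
    interpret pair_graph H by fact
    show ?thesis by unfold_locales
  qed
  show "(\<lambda>H. (pverts H, parcs H)) \<in> subtrees T \<rightarrow> conn_subgraphs (pverts T) (parcs T)"
    using connected_iff_conn_graph by (auto simp: subtrees_def conn_subgraphs_def subgraph_def)
  show "(\<lambda>(W, F). \<lparr> pverts = W, parcs = F \<rparr>) \<in> conn_subgraphs (pverts T) (parcs T) \<rightarrow> subtrees T"
  proof (clarsimp)
    fix W F assume WF: "(W, F) \<in> conn_subgraphs (pverts T) (parcs T)"
    let ?H = "\<lparr> pverts = W, parcs = F \<rparr>"
    have sub: "W \<subseteq> pverts T" "F \<subseteq> parcs T" and c: "conn_graph W F"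
      using WF by (auto simp: conn_subgraphs_def)
    have H: "pair_graph ?H"
      using assms c sub by (auto simp: pair_graph_iff conn_graph_def irrefl_def)
    then show "?H \<in> subtrees T"
      using connected_iff_conn_graph[OF H] c sub wf[OF H] wf[OF assms]
      by (auto simp: subtrees_def subgraph_def compatible_def)
  qed
qed auto

lemma poly_subtree_poly:
  assumes "pair_graph T"
  shows "poly (subtree_poly T) z = sub_poly (pverts T) (parcs T) z"
proof -
  let ?V = "pverts T"
  have finV: "finite ?V" and EV: "parcs T \<subseteq> ?V \<times> ?V" using assms by (auto simp: pair_graph_iff)
  have "finite (subtrees T)"
    using bij_betw_finite[OF subtrees_bij[OF assms]] finite_conn_subgraphs[OF finV EV] by blast
  moreover have "card (pverts H) \<in> {1..card ?V}" if "H \<in> subtrees T" for H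
  proof -
    have "(pverts H, parcs H) \<in> conn_subgraphs ?V (parcs T)"
      using bij_betwE[OF subtrees_bij[OF assms]] that by blast
    then have "pverts H \<subseteq> ?V" "finite (pverts H)" "pverts H \<noteq> {}"
      by (auto simp: conn_subgraphs_def conn_graph_def)
    then show ?thesis using card_mono[OF finV] by (auto simp: Suc_le_eq card_gt_0_iff)
  qed
  ultimately have "(\<Sum>H \<in> subtrees T. z ^ card (pverts H)) =
    (\<Sum>k = 1..card ?V. \<Sum>H \<in> {H \<in> subtrees T. card (pverts H) = k}. z ^ card (pverts H))"
    by (intro sum.group[symmetric]) auto
  also have "\<dots> = (\<Sum>k = 1..card ?V. of_nat (num_subtrees T k) * z ^ k)"
    by (intro sum.cong refl) (simp add: num_subtrees_def)
  also have "\<dots> = poly (subtree_poly T) z"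
    by (simp add: subtree_poly_def poly_sum poly_monom)
  also have "(\<Sum>H \<in> subtrees T. z ^ card (pverts H)) = sub_poly ?V (parcs T) z"
    unfolding sub_poly_def using sum.reindex_bij_betw[OF subtrees_bij[OF assms], of "\<lambda>(W, F). z ^ card W"]
    by simp
  finally show ?thesis by simp
qed

lemma star_imp_iso_star_graph:
  assumes T: "pair_graph T" and star: "is_star (pverts T) (parcs T) c"
  shows "digraph_iso (with_proj T) (with_proj (star_graph (card (pverts T))))"
proof -
  let ?V = "pverts T" and ?n = "card (pverts T)"
  interpret pair_graph T by fact
  have cV: "c \<in> ?V" and E: "parcs T = {c} \<times> (?V - {c}) \<union> (?V - {c}) \<times> {c}"
    using star by (auto simp: is_star_def)
  have fin: "finite ?V" using T by (simp add: pair_graph_iff)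
  then have n: "?n \<ge> 1" using cV by (auto simp: Suc_le_eq card_gt_0_iff)
  have "card (?V - {c}) = card {1..<?n}" using fin cV by simp
  then obtain h where h: "bij_betw h (?V - {c}) {1..<?n}"
    using finite_same_card_bij fin by (metis finite_Diff finite_atLeastLessThan)
  define g where "g = h(c := 0)"
  have gc: "g c = 0" and gh: "g ` (?V - {c}) = {1..<?n}"
    using h by (auto simp: g_def bij_betw_def)
  have inj': "inj_on g (?V - {c})"
    using h by (auto simp: g_def bij_betw_def inj_on_def)
  have "g c \<notin> g ` (?V - {c} - {c})" using gc gh by simp
  then have "inj_on g (insert c (?V - {c}))" using inj' unfolding inj_on_insert by blast
  then have inj: "inj_on g ?V" unfolding insert_Diff[OF cV] .
  have "?V = insert c (?V - {c})" using cV by blast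
  then have "g ` ?V = insert 0 {1..<?n}" using gc gh by (metis image_insert)
  then have img: "g ` ?V = {..<?n}" using n by auto
  let ?f = "\<lparr> iso_verts = g, iso_arcs = map_prod g g, iso_head = snd, iso_tail = fst \<rparr>"
  have "inj_on (map_prod g g) (?V \<times> ?V)" using map_prod_inj_on[OF inj inj] .
  then have "inj_on (map_prod g g) (parcs T)"
    using T by (auto simp: pair_graph_iff intro: inj_on_subset)
  then have "digraph_isomorphism ?f"
    unfolding digraph_isomorphism_def using inj wf_digraph_axioms by auto
  moreover have "map_prod g g ` parcs T = parcs (star_graph ?n)"
  proof -
    have g0: "g ` {c} = {0}" using gc by simp
    then show ?thesis
      using map_prod_surj_on[OF g0 gh] map_prod_surj_on[OF gh g0]
      by (simp only: E star_graph_def image_Un pair_pre_digraph.select_convs)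
  qed
  then have "with_proj (star_graph ?n) = app_iso ?f (with_proj T)"
    using img by (simp add: app_iso_def with_proj_def star_graph_def)
  ultimately show ?thesis unfolding digraph_iso_def by blast
qed

text \<open>
  The isomorphism also carries tail and head functions of its own; since those of the target are the
  projections, its action on arcs is determined by its action on vertices.
\<close>

lemma iso_star_graph_imp_star:
  assumes T: "pair_graph T" and n: "n \<ge> 1"
    and iso: "digraph_iso (with_proj T) (with_proj (star_graph n))"
  obtains c where "is_star (pverts T) (parcs T) c"
proof -
  interpret pair_graph T by fact
  obtain f where f: "digraph_isomorphism f" and app: "with_proj (star_graph n) = app_iso f (with_proj T)"
    using iso by (auto simp: digraph_iso_def)
  define g where "g = iso_verts f"
  have inj: "inj_on g (pverts T)" using f by (simp add: digraph_isomorphism_def g_def)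
  have img: "g ` pverts T = {..<n}"
    using arg_cong[OF app, of verts] by (simp add: star_graph_def g_def)
  have arcs: "iso_arcs f ` parcs T = parcs (star_graph n)"
    using arg_cong[OF app, of arcs] by simp
  have ht: "iso_tail f = fst" "iso_head f = snd"
    using arg_cong[OF app, of tail] arg_cong[OF app, of head] by simp_all
  have "iso_arcs f e = map_prod g g e" if "e \<in> parcs T" for e
    using f that by (auto simp: digraph_isomorphism_def ht g_def prod_eq_iff)
  then have E: "map_prod g g ` parcs T = parcs (star_graph n)" using arcs by (metis image_cong)
  have EV: "parcs T \<subseteq> pverts T \<times> pverts T" using T by (simp add: pair_graph_iff)
  obtain c where c: "c \<in> pverts T" "g c = 0" using img n by (metis image_iff lessThan_iff less_eq_Suc_le One_nat_def)
  have g0: "g x = 0 \<longleftrightarrow> x = c" if "x \<in> pverts T" for x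
    using inj c that by (metis inj_onD)
  have "(x, y) \<in> parcs T \<longleftrightarrow> (x = c) \<noteq> (y = c)" if xy: "x \<in> pverts T" "y \<in> pverts T" for x y
  proof -
    have "(x, y) \<in> parcs T \<longleftrightarrow> (g x, g y) \<in> map_prod g g ` parcs T"
    proof
      assume "(g x, g y) \<in> map_prod g g ` parcs T"
      then obtain a b where ab: "(a, b) \<in> parcs T" "g a = g x" "g b = g y" by auto
      then have "a = x" "b = y" using inj xy EV by (auto dest: inj_onD)
      then show "(x, y) \<in> parcs T" using ab by simp
    qed force
    also have "\<dots> \<longleftrightarrow> (g x = 0) \<noteq> (g y = 0)"
      using img xy unfolding E by (auto simp: star_graph_def)
    finally show ?thesis using g0 xy by simp
  qed
  then have "parcs T = {c} \<times> (pverts T - {c}) \<union> (pverts T - {c}) \<times> {c}"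
    using EV c by auto
  then show ?thesis using that c by (simp add: is_star_def)
qed

section \<open>The disk and its boundary\<close>

theorem theorem1p3:
  fixes T :: "'a pair_pre_digraph" and n :: nat
  assumes "undirected_tree T" and "card (pverts T) = n" and "n \<ge> 2"
  shows "(\<forall>z \<in> subtree_roots T. norm z \<le> 1 + root (n - 1) (real (n - 1))) \<and>
    ((\<exists>z \<in> subtree_roots T. norm z = 1 + root (n - 1) (real (n - 1))) \<longleftrightarrow>
       even n \<and> digraph_iso (with_proj T) (with_proj (star_graph n))) \<and>
    (even n \<and> digraph_iso (with_proj T) (with_proj (star_graph n)) \<longrightarrow>
       {z \<in> subtree_roots T. norm z = 1 + root (n - 1) (real (n - 1))} =
         {complex_of_real (- 1 - root (n - 1) (real (n - 1)))})"
proof -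
  define V E r where "V = pverts T" and "E = parcs T" and "r = root (n - 1) (real (n - 1))"
  have T: "pair_graph T" using assms(1) by (simp add: undirected_tree_def)
  have tree: "bridge_tree V E" using undirected_tree_imp_bridge_tree[OF assms(1)] by (simp add: V_def E_def)
  have conn: "conn_graph V E" using tree by (simp add: bridge_tree_def)
  have n: "card V = n" using assms(2) by (simp add: V_def)
  have roots: "z \<in> subtree_roots T \<longleftrightarrow> sub_poly V E z = 0" for z
    using poly_subtree_poly[OF T] by (simp add: subtree_roots_def V_def E_def)
  have r1: "1 \<le> r" using assms(3) by (simp add: r_def)
  have rpow: "r ^ (n - 1) = real (n - 1)" using assms(3) by (simp add: r_def)
  have bound: "norm z \<le> 1 + r" if "sub_poly V E z = 0" for z
  proof (rule ccontr)
    assume "\<not> ?thesis"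
    then have "r < norm z - 1" by simp
    then have "r ^ (n - 1) < (norm z - 1) ^ (n - 1)"
      using r1 assms(3) by (intro power_strict_mono) auto
    then have "sub_poly V E z \<noteq> 0"
      using sub_poly_nonzero[OF tree, of "norm z - 1" z] r1 \<open>r < norm z - 1\<close> rpow n by simp
    then show False using that by simp
  qed
  have to_iso: "digraph_iso (with_proj T) (with_proj (star_graph n))"
    if zero: "sub_poly V E z = 0" and bd: "norm z = 1 + r" for z
  proof -
    have rV: "r ^ (card V - 1) = real (card V - 1)" and "2 \<le> card V" using rpow n assms(3) by simp_all
    obtain c where "is_star V E c"
      by (rule leaf_edges_imp_star[OF conn bridge_tree_irrefl[OF tree] \<open>2 \<le> card V\<close>
        boundary_zero_edge[OF tree r1 bd rV zero]])
    then show ?thesis using star_imp_iso_star_graph[OF T] n by (simp add: V_def E_def)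
  qed
  have star_roots: "sub_poly V E z = 0 \<and> norm z = 1 + r \<longleftrightarrow> even n \<and> z = complex_of_real (- 1 - r)"
    if iso: "digraph_iso (with_proj T) (with_proj (star_graph n))" for z
  proof -
    have "n \<ge> 1" using assms(3) by simp
    then obtain c where "is_star (pverts T) (parcs T) c"
      using iso_star_graph_imp_star[OF T _ iso] by metis
    then have "is_star V E c" by (simp add: V_def E_def)
    moreover have "finite V" "card V = Suc (n - 1)" using conn n assms(3) by (simp_all add: conn_graph_def)
    ultimately have "sub_poly V E z = z * (1 + z) ^ (n - 1) + of_nat (n - 1) * z"
      using star_poly[of V E c "n - 1" z] by simp
    moreover have "odd (n - 1) \<longleftrightarrow> even n" using assms(3) by auto
    ultimately show ?thesis
      using star_boundary_root[of "n - 1" r z] r1 rpow assms(3) by simp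
  qed
  show ?thesis
    unfolding r_def[symmetric] Bex_def Ball_def roots
    using bound to_iso star_roots by blast
qed

end
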